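(* Suppose $G=(V,E)$ is a connected graph with metamour period $2$. Then $\operatorname{M}(G)$ is connected and either \[ \operatorname{diam}(G)=\operatorname{diam}(\operatorname{M}(G))=2 \quad\text{with}\quad \operatorname{M}(G)=\overline{G}, \] or \[ \operatorname{diam}(G)=\operatorname{diam}(\operatorname{M}(G))=3 \quad\text{with}\quad \operatorname{M}(G)\subsetneq\overline{G}. \] Moreover, for all distinct $x,y\in V$, we have \begin{align*} d_G(x,y)=1 &\iff d_{\operatorname{M}(G)}(x,y)=2,\\ d_G(x,y)=2 &\iff d_{\operatorname{M}(G)}(x,y)=1,\\ d_G(x,y)=3 &\iff d_{\operatorname{M}(G)}(x,y)=3. \end{align*}
   Context: All graphs are finite and simple. $d_G$ is the graph distance and $\operatorname{diam}(G)$ its maximum value; $\overline{G}$ is the complement; $\subsetneq$ means proper subgraph. The metamour graph $\operatorname{M}(G)$ has vertex set $V(G)$, with $x,y$ adjacent iff $d_G(x,y)=2$. $G$ has metamour period $2$ if $\operatorname{M}(\operatorname{M}(G))=G$ (equality as labeled graphs) and $\operatorname{M}(G)\ne G$. *)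

theory Defs
  imports "Graph_Theory.Graph_Theory"
begin

text \<open>
  A finite simple graph is a \<open>pair_graph\<close>: an undirected edge between \<open>u\<close> and \<open>v\<close> is the pair
  of arcs \<open>(u, v)\<close>, \<open>(v, u)\<close>.  Equality of \<open>pair_pre_digraph\<close> records is equality of labeled
  graphs.
\<close>

text \<open>Unit arc weights; the distance is \<open>\<infinity>\<close> if there is no walk from \<open>u\<close> to \<open>v\<close>.\<close>

definition gdist :: "'a pair_pre_digraph \<Rightarrow> 'a \<Rightarrow> 'a \<Rightarrow> ereal" where
  "gdist G u v = wf_digraph.\<mu> (with_proj G) (\<lambda>_. 1) u v"

text \<open>Meaningful for nonempty finite graphs only; \<open>\<infinity>\<close> for disconnected ones.\<close>

definition diam :: "'a pair_pre_digraph \<Rightarrow> ereal" where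
  "diam G = Max {gdist G u v | u v. u \<in> pverts G \<and> v \<in> pverts G}"

definition complement_graph :: "'a pair_pre_digraph \<Rightarrow> 'a pair_pre_digraph" where
  "complement_graph G =
     \<lparr> pverts = pverts G,
       parcs = {(u, v). u \<in> pverts G \<and> v \<in> pverts G \<and> u \<noteq> v \<and> (u, v) \<notin> parcs G} \<rparr>"

definition proper_subgraph :: "'a pair_pre_digraph \<Rightarrow> 'a pair_pre_digraph \<Rightarrow> bool" where
  "proper_subgraph H G \<longleftrightarrow> subgraph (with_proj H) (with_proj G) \<and> H \<noteq> G"

definition metamour :: "'a pair_pre_digraph \<Rightarrow> 'a pair_pre_digraph" where
  "metamour G =
     \<lparr> pverts = pverts G,
       parcs = {(u, v). u \<in> pverts G \<and> v \<in> pverts G \<and> gdist G u v = 2} \<rparr>"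

definition metamour_period_2 :: "'a pair_pre_digraph \<Rightarrow> bool" where
  "metamour_period_2 G \<longleftrightarrow> metamour (metamour G) = G \<and> metamour G \<noteq> G"

lemma gdist_eq_INF_length:
  assumes "pair_wf_digraph G"
  shows "gdist G u v = (INF p\<in>{p. pre_digraph.awalk (with_proj G) u p v}. ereal (real (length p)))"
proof -
  interpret pair_wf_digraph G by fact
  have "awalk_cost (\<lambda>_. 1) p = real (length p)" for p :: "('a \<times> 'a) list"
    by (induct p) auto
  then show ?thesis
    unfolding gdist_def \<mu>_def by simp
qed

lemma (in pair_graph) awalk_reverse:
  assumes "awalk u p v"
  shows "awalk v (rev (map prod.swap p)) u"
  using assms
proof (induct p arbitrary: u)
  case Nil
  then show ?case by (auto simp: awalk_Nil_iff)
next
  case (Cons e p)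
  obtain a b where e: "e = (a, b)" by (cases e)
  from Cons.prems have *: "(a, b) \<in> parcs G" "u = a" "awalk b p v"
    by (auto simp: e awalk_Cons_iff)
  then have "(b, a) \<in> parcs G"
    using arcs_symmetric by blast
  then have "awalk b [(b, a)] a"
    by (auto simp: awalk_Cons_iff awalk_Nil_iff dest: in_arcsD1 in_arcsD2)
  with Cons.hyps[OF *(3)] show ?case
    by (auto simp: e *(2))
qed

lemma gdist_sym:
  assumes "pair_graph G"
  shows "gdist G u v = gdist G v u"
proof -
  interpret pair_graph G by fact
  have le: "gdist G x y \<le> gdist G y x" for x y
    unfolding gdist_eq_INF_length[OF pair_wf_digraph_axioms]
  proof (rule INF_greatest)
    fix p assume "p \<in> {p. awalk y p x}"
    then have "awalk x (rev (map prod.swap p)) y"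
      by (simp add: awalk_reverse)
    then show "(INF p\<in>{p. awalk x p y}. ereal (real (length p))) \<le> ereal (real (length p))"
      by (intro INF_lower2[of "rev (map prod.swap p)"]) auto
  qed
  then show ?thesis by (intro antisym)
qed

lemma gdist_self:
  assumes "pair_wf_digraph G" "u \<in> pverts G"
  shows "gdist G u u = 0"
proof -
  interpret pair_wf_digraph G by fact
  have "awalk u [] u" using assms(2) by (simp add: awalk_Nil_iff)
  then have "gdist G u u \<le> 0"
    unfolding gdist_eq_INF_length[OF pair_wf_digraph_axioms] by (intro INF_lower2[of "[]"]) auto
  moreover have "0 \<le> gdist G u u"
    unfolding gdist_eq_INF_length[OF pair_wf_digraph_axioms] by (rule INF_greatest) auto
  ultimately show ?thesis by (rule antisym)
qed

lemma pair_graph_metamour: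
  assumes "pair_graph G"
  shows "pair_graph (metamour G)"
proof -
  interpret pair_graph G by fact
  have fin: "finite (parcs (metamour G))"
    by (rule finite_subset[of _ "pverts G \<times> pverts G"]) (auto simp: metamour_def)
  show ?thesis
    by unfold_locales
      (use fin gdist_sym[OF assms] gdist_self[OF pair_wf_digraph_axioms] in
        \<open>auto simp: metamour_def symmetric_def sym_def\<close>)
qed

lemma pair_graph_complement_graph:
  assumes "pair_graph G"
  shows "pair_graph (complement_graph G)"
proof -
  interpret pair_graph G by fact
  have fin: "finite (parcs (complement_graph G))"
    by (rule finite_subset[of _ "pverts G \<times> pverts G"]) (auto simp: complement_graph_def)
  show ?thesis
    by unfold_locales
      (use fin arcs_symmetric in \<open>auto simp: complement_graph_def symmetric_def sym_def\<close>)
qed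

end

theory Submission
  imports Defs
begin

text \<open>
  Write \<open>M\<close> for the metamour graph of \<open>G\<close>.  By definition, distance \<open>2\<close> in \<open>G\<close> is adjacency in
  \<open>M\<close>; the hypothesis \<open>M(M(G)) = G\<close> adds that distance \<open>2\<close> in \<open>M\<close> is adjacency in \<open>G\<close>.  Hence
  adjacent vertices of \<open>G\<close> are joined by a walk of length \<open>2\<close> in \<open>M\<close>, so \<open>M\<close> is connected as soon
  as \<open>G\<close> is (\<open>connected_metamour\<close>), and then \<open>G\<close> and \<open>M\<close> play symmetric roles, because
  \<open>M(M(M)) = M\<close>.

  The key point is that no distance exceeds \<open>3\<close> (\<open>gdist_le_3_if_metamour_involutive\<close>).  Otherwise
  a geodesic contains vertices \<open>u\<close>, \<open>v\<close> at distance \<open>4\<close>, and the middle vertex \<open>m\<close> between them is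
  at distance \<open>2\<close> from both.  Then \<open>u - m - v\<close> is a path in \<open>M\<close> whose ends are not adjacent in
  \<open>M\<close>, so they have distance \<open>2\<close> in \<open>M\<close>, which makes them adjacent in \<open>G\<close>: a contradiction.

  So in both graphs the distances between distinct vertices lie in \<open>{1, 2, 3}\<close>.  Passing from \<open>G\<close>
  to \<open>M\<close> exchanges \<open>1\<close> and \<open>2\<close>, and therefore keeps \<open>3\<close>.  The diameters are decided by whether
  the distance \<open>3\<close> occurs, and it occurs exactly if some pair of distinct vertices is adjacent in
  neither graph, that is, if \<open>M\<close> is smaller than the complement of \<open>G\<close>.  The diameters are not
  below \<open>2\<close>, because \<open>M \<noteq> G\<close> forces both graphs to have an edge.
\<close>

section \<open>Distances and geodesics\<close>

context pair_wf_digraph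
begin

lemma gdist_le_length: "awalk u p v \<Longrightarrow> gdist G u v \<le> ereal (real (length p))"
  unfolding gdist_eq_INF_length[OF pair_wf_digraph_axioms] by (auto intro: INF_lower2)

lemma gdist_less_infinity_iff_reachable: "gdist G u v < \<infinity> \<longleftrightarrow> u \<rightarrow>\<^sup>*\<^bsub>with_proj G\<^esub> v"
  unfolding gdist_def by (rule \<mu>_reach_conv)

lemma geodesicE:
  assumes "gdist G u v \<noteq> \<infinity>"
  obtains p where "awalk u p v" "gdist G u v = ereal (real (length p))"
proof -
  have "\<exists>q. awalk u q v"
    using assms unfolding reachable_awalk[symmetric] gdist_less_infinity_iff_reachable[symmetric]
    by simp
  then obtain p where p: "awalk u p v" "\<And>q. awalk u q v \<Longrightarrow> length p \<le> length q"
    using ex_has_least_nat[of "\<lambda>q. awalk u q v" _ length] by blast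
  have "gdist G u v = ereal (real (length p))"
    using gdist_le_length[OF p(1)] p(2)
    unfolding gdist_eq_INF_length[OF pair_wf_digraph_axioms]
    by (intro antisym INF_greatest) auto
  with p(1) show thesis by (rule that)
qed

lemma gdist_triangle: "gdist G u w \<le> gdist G u v + gdist G v w"
proof (cases "gdist G u v \<noteq> \<infinity> \<and> gdist G v w \<noteq> \<infinity>")
  case True
  then obtain p q where "awalk u p v" "gdist G u v = ereal (real (length p))"
    and "awalk v q w" "gdist G v w = ereal (real (length q))"
    by (meson geodesicE)
  moreover from this have "awalk u (p @ q) w" by (blast intro: awalk_appendI)
  ultimately show ?thesis using gdist_le_length[of u "p @ q" w] by simp
qed auto

lemma gdist_eq_0_iff: "gdist G u v = 0 \<longleftrightarrow> u \<in> pverts G \<and> u = v"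
proof
  assume *: "gdist G u v = 0"
  then have "gdist G u v \<noteq> \<infinity>" by simp
  then obtain p where "awalk u p v" "gdist G u v = ereal (real (length p))"
    by (rule geodesicE)
  with * show "u \<in> pverts G \<and> u = v" by (auto simp: awalk_Nil_iff)
qed (auto simp: gdist_self[OF pair_wf_digraph_axioms])

text \<open>
  Cut a geodesic after \<open>k\<close> arcs: neither piece can be replaced by a shorter walk, since by the
  triangle inequality this would shorten the whole.
\<close>

lemma geodesic_splitE:
  assumes "gdist G u v = ereal (real n)" "k \<le> n"
  obtains w where "w \<in> pverts G" "gdist G u w = ereal (real k)" "gdist G w v = ereal (real (n - k))"
proof -
  have "gdist G u v \<noteq> \<infinity>" using assms(1) by simp
  then obtain p where "awalk u p v" "gdist G u v = ereal (real (length p))" by (rule geodesicE)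
  with assms(1) have p: "awalk u p v" "length p = n" by simp_all
  define w where "w = awlast u (take k p)"
  have "awalk u (take k p @ drop k p) v" using p by simp
  then have w: "awalk u (take k p) w" "awalk w (drop k p) v"
    unfolding w_def awalk_append_iff by auto
  from w have le: "gdist G u w \<le> ereal (real k)" "gdist G w v \<le> ereal (real (n - k))"
    using gdist_le_length[OF w(1)] gdist_le_length[OF w(2)] p(2) assms(2) by auto
  obtain a b where ab: "gdist G u w = ereal (real a)" "gdist G w v = ereal (real b)"
  proof -
    from le have "gdist G u w \<noteq> \<infinity>" "gdist G w v \<noteq> \<infinity>" by auto
    then show thesis by (metis geodesicE that)
  qed
  have "ereal (real n) \<le> ereal (real a) + ereal (real b)"
    using gdist_triangle[of u v w] assms(1) ab by simp
  with le ab assms(2) have "a = k" "b = n - k" by auto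
  with ab w show thesis by (auto intro: that awalk_last_in_verts)
qed

end

context pair_graph
begin

lemma gdist_eq_1_iff: "gdist G u v = 1 \<longleftrightarrow> (u, v) \<in> parcs G"
proof
  assume *: "gdist G u v = 1"
  then have "gdist G u v \<noteq> \<infinity>" by simp
  then obtain p where p: "awalk u p v" "gdist G u v = ereal (real (length p))"
    by (rule geodesicE)
  with * have "length p = 1" by simp
  then obtain e where "p = [e]" by (auto simp: length_Suc_conv)
  with p(1) show "(u, v) \<in> parcs G" by (cases e) (auto simp: awalk_simps)
next
  assume uv: "(u, v) \<in> parcs G"
  then have "awalk u [(u, v)] v" by (auto simp: awalk_simps dest: in_arcsD1 in_arcsD2)
  note w = this gdist_le_length[OF this]
  then have "gdist G u v \<noteq> \<infinity>" by auto
  then obtain p where "awalk u p v" and p: "gdist G u v = ereal (real (length p))"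
    by (rule geodesicE)
  have "u \<noteq> v" using pair_no_loops[OF uv] by simp
  then have "gdist G u v \<noteq> 0" by (simp add: gdist_eq_0_iff)
  with p w(2) show "gdist G u v = 1" by (cases "length p") (auto simp: one_ereal_def)
qed

lemma connected_iff_gdist_finite:
  "Digraph_Component.connected (with_proj G) \<longleftrightarrow>
     pverts G \<noteq> {} \<and> (\<forall>u\<in>pverts G. \<forall>v\<in>pverts G. gdist G u v < \<infinity>)"
  unfolding connected_def strongly_connected_def gdist_less_infinity_iff_reachable
    reachable_mk_symmetric_eq[OF pair_sym_arcs]
  by (simp add: mk_symmetric_def)

lemma gdist_cases_if_le_3:
  assumes "u \<in> pverts G" "u \<noteq> v" "gdist G u v \<le> 3"
  shows "gdist G u v \<in> {1, 2, 3}"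
proof -
  have "gdist G u v \<noteq> \<infinity>" using assms(3) by auto
  then obtain p where "awalk u p v" and p: "gdist G u v = ereal (real (length p))"
    by (rule geodesicE)
  have "gdist G u v \<noteq> 0" using assms by (simp add: gdist_eq_0_iff)
  with p assms(3) have "length p \<in> {1, 2, 3}"
    by (auto simp: numeral_3_eq_3 le_Suc_eq)
  with p show ?thesis by auto
qed

text \<open>\<open>Max\<close> is determined by its order properties only on finite sets; here finiteness of the graph enters.\<close>

lemma diam_eqI:
  assumes "\<And>u v. u \<in> pverts G \<Longrightarrow> v \<in> pverts G \<Longrightarrow> gdist G u v \<le> d"
    and "x \<in> pverts G" "y \<in> pverts G" "gdist G x y = d"
  shows "diam G = d"
  unfolding diam_def
proof (rule Max_eqI)
  have "{gdist G u v |u v. u \<in> pverts G \<and> v \<in> pverts G}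
      = (\<lambda>(u, v). gdist G u v) ` (pverts G \<times> pverts G)" by auto
  then show "finite {gdist G u v |u v. u \<in> pverts G \<and> v \<in> pverts G}"
    using pair_finite_verts by simp
qed (use assms in auto)

end

section \<open>Graphs that are the metamour graph of their metamour graph\<close>

lemma pverts_metamour [simp]: "pverts (metamour G) = pverts G"
  by (simp add: metamour_def)

lemma parcs_metamour_iff:
  "(u, v) \<in> parcs (metamour G) \<longleftrightarrow> u \<in> pverts G \<and> v \<in> pverts G \<and> gdist G u v = 2"
  by (simp add: metamour_def)

lemma gdist_metamour_eq_1_iff:
  assumes "pair_graph G" "u \<in> pverts G" "v \<in> pverts G"
  shows "gdist (metamour G) u v = 1 \<longleftrightarrow> gdist G u v = 2"
  using pair_graph.gdist_eq_1_iff[OF pair_graph_metamour[OF assms(1)]] assms(2,3)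
  by (simp add: parcs_metamour_iff)

lemma gdist_metamour_eq_2_iff:
  assumes "pair_graph G" "metamour (metamour G) = G" "u \<in> pverts G" "v \<in> pverts G"
  shows "gdist (metamour G) u v = 2 \<longleftrightarrow> gdist G u v = 1"
  using gdist_metamour_eq_1_iff[OF pair_graph_metamour[OF assms(1)], of u v] assms(2-4) by simp

text \<open>
  Every arc of \<open>G\<close> joins vertices at the finite distance \<open>2\<close> in the metamour graph, so a walk in
  \<open>G\<close> can be replaced by one in the metamour graph.
\<close>

lemma connected_metamour:
  assumes "pair_graph G" "metamour (metamour G) = G"
    and "Digraph_Component.connected (with_proj G)"
  shows "Digraph_Component.connected (with_proj (metamour G))"
proof -
  interpret pair_graph G by fact
  interpret M: pair_graph "metamour G" by (rule pair_graph_metamour) fact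
  have reach: "u \<rightarrow>\<^sup>*\<^bsub>with_proj (metamour G)\<^esub> v" if "u \<rightarrow>\<^sup>*\<^bsub>with_proj G\<^esub> v" for u v
    using that
  proof (induct rule: reachable_induct)
    case base
    then show ?case by (simp add: M.reachable_refl)
  next
    case (step x y)
    then have "x \<in> pverts G" "y \<in> pverts G" "gdist G x y = 1"
      by (auto simp: gdist_eq_1_iff dest: in_arcsD1 in_arcsD2)
    then have "gdist (metamour G) x y = 2"
      using gdist_metamour_eq_2_iff[OF assms(1,2)] by blast
    then have "x \<rightarrow>\<^sup>*\<^bsub>with_proj (metamour G)\<^esub> y"
      by (simp flip: M.gdist_less_infinity_iff_reachable)
    with step.hyps show ?case by (blast intro: M.reachable_trans)
  qed
  show ?thesis
    using assms(3) reach
    unfolding connected_iff_gdist_finite M.connected_iff_gdist_finite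
      gdist_less_infinity_iff_reachable M.gdist_less_infinity_iff_reachable by simp
qed

text \<open>
  Two consecutive metamour arcs whose ends are at distance \<open>4\<close> would witness a metamour distance
  of \<open>2\<close>, which is reserved for the arcs of \<open>G\<close>.
\<close>

lemma gdist_neq_4_if_metamour_involutive:
  assumes "pair_graph G" "metamour (metamour G) = G" "u \<in> pverts G" "v \<in> pverts G"
  shows "gdist G u v \<noteq> 4"
proof
  assume d4: "gdist G u v = 4"
  interpret pair_graph G by fact
  interpret M: pair_graph "metamour G" by (rule pair_graph_metamour) fact
  obtain m where m: "m \<in> pverts G" "gdist G u m = 2" "gdist G m v = 2"
    by (rule geodesic_splitE[of u v 4 2]) (use d4 in auto)
  have "gdist (metamour G) u v \<le> 1 + 1"
    using M.gdist_triangle[of u v m] m assms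
    by (simp add: gdist_metamour_eq_1_iff[OF assms(1), THEN iffD2])
  then have le2: "gdist (metamour G) u v \<le> 2" by simp
  have "u \<noteq> v" using d4 assms(3) by (auto simp: gdist_self[OF pair_wf_digraph_axioms])
  moreover have "gdist (metamour G) u v \<le> 3" using le2 by (rule order_trans) simp
  ultimately have "gdist (metamour G) u v \<in> {1, 2, 3}"
    using assms(3) by (intro M.gdist_cases_if_le_3) auto
  with le2 have "gdist (metamour G) u v = 1 \<or> gdist (metamour G) u v = 2" by auto
  then have "gdist G u v = 2 \<or> gdist G u v = 1"
    using gdist_metamour_eq_1_iff[OF assms(1,3,4)] gdist_metamour_eq_2_iff[OF assms] by blast
  with d4 show False by auto
qed

lemma gdist_le_3_if_metamour_involutive:
  assumes "pair_graph G" "metamour (metamour G) = G"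
    and "Digraph_Component.connected (with_proj G)" "u \<in> pverts G" "v \<in> pverts G"
  shows "gdist G u v \<le> 3"
proof (rule ccontr)
  interpret pair_graph G by fact
  assume far: "\<not> gdist G u v \<le> 3"
  have "gdist G u v \<noteq> \<infinity>" using assms(3-5) by (simp add: connected_iff_gdist_finite)
  then obtain p where "awalk u p v" and p: "gdist G u v = ereal (real (length p))"
    by (rule geodesicE)
  with far have "4 \<le> length p" by simp
  then obtain w where "w \<in> pverts G" "gdist G u w = 4"
    using geodesic_splitE[OF p, of 4] by auto
  with gdist_neq_4_if_metamour_involutive[OF assms(1,2,4)] show False by blast
qed

text \<open>
  Without arcs the distance \<open>2\<close> does not occur, so the metamour graph has no arcs either.  For a
  graph of metamour period \<open>2\<close>, this applied to the graph and to its metamour graph yields an arc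
  in each of them, and so both distances \<open>1\<close> and \<open>2\<close> occur.
\<close>

lemma metamour_eq_self_if_parcs_empty:
  assumes "pair_graph G" "parcs G = {}"
  shows "metamour G = G"
proof -
  interpret pair_graph G by fact
  have "gdist G u v \<noteq> 2" for u v
  proof
    assume "gdist G u v = 2"
    then obtain w where "gdist G u w = 1"
      using geodesic_splitE[of u v 2 1] by (auto simp: one_ereal_def)
    with assms(2) show False by (simp add: gdist_eq_1_iff)
  qed
  with assms(2) show ?thesis by (simp add: metamour_def)
qed

section \<open>Metamour period 2\<close>

theorem theorem6p5:
  fixes G :: "'a pair_pre_digraph"
  assumes "pair_graph G"
    and "Digraph_Component.connected (with_proj G)"
    and "metamour_period_2 G"
  shows "Digraph_Component.connected (with_proj (metamour G))
    \<and> ((diam G = 2 \<and> diam (metamour G) = 2 \<and> metamour G = complement_graph G)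
       \<or> (diam G = 3 \<and> diam (metamour G) = 3
          \<and> proper_subgraph (metamour G) (complement_graph G)))
    \<and> (\<forall>x\<in>pverts G. \<forall>y\<in>pverts G. x \<noteq> y \<longrightarrow>
         (gdist G x y = 1 \<longleftrightarrow> gdist (metamour G) x y = 2)
         \<and> (gdist G x y = 2 \<longleftrightarrow> gdist (metamour G) x y = 1)
         \<and> (gdist G x y = 3 \<longleftrightarrow> gdist (metamour G) x y = 3))"
proof -
  let ?M = "metamour G" and ?C = "complement_graph G"
  interpret pair_graph G by fact
  interpret M: pair_graph ?M by (rule pair_graph_metamour) fact
  interpret C: pair_graph ?C by (rule pair_graph_complement_graph) fact
  have inv: "metamour ?M = G" and neq: "?M \<noteq> G"
    using assms(3) by (auto simp: metamour_period_2_def)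
  then have invM: "metamour (metamour ?M) = ?M" by simp
  have conn: "Digraph_Component.connected (with_proj ?M)"
    using connected_metamour assms(1,2) inv by blast
  note one = gdist_metamour_eq_1_iff[OF assms(1)]
  note two = gdist_metamour_eq_2_iff[OF assms(1) inv]
  have le3: "gdist G u v \<le> 3" "gdist ?M u v \<le> 3" if "u \<in> pverts G" "v \<in> pverts G" for u v
    using gdist_le_3_if_metamour_involutive[OF assms(1) inv assms(2) that]
      gdist_le_3_if_metamour_involutive[OF M.pair_graph_axioms invM conn] that by auto
  have cases: "gdist G u v \<in> {1, 2, 3}" "gdist ?M u v \<in> {1, 2, 3}"
    if "u \<in> pverts G" "v \<in> pverts G" "u \<noteq> v" for u v
    using gdist_cases_if_le_3[OF that(1,3) le3(1)[OF that(1,2)]]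
      M.gdist_cases_if_le_3[OF _ that(3) le3(2)[OF that(1,2)]] that by simp_all
  have three: "gdist G u v = 3 \<longleftrightarrow> gdist ?M u v = 3"
    if "u \<in> pverts G" "v \<in> pverts G" "u \<noteq> v" for u v
  proof -
    have "gdist G u v = 3 \<longleftrightarrow> gdist G u v \<noteq> 1 \<and> gdist G u v \<noteq> 2"
      "gdist ?M u v = 3 \<longleftrightarrow> gdist ?M u v \<noteq> 1 \<and> gdist ?M u v \<noteq> 2"
      using cases[OF that] by auto
    then show ?thesis using one[OF that(1,2)] two[OF that(1,2)] by blast
  qed
  have M_sub_C: "parcs ?M \<subseteq> parcs ?C"
    by (auto simp: parcs_metamour_iff complement_graph_def gdist_self[OF pair_wf_digraph_axioms]
        simp flip: gdist_eq_1_iff)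
  have "(diam G = 2 \<and> diam ?M = 2 \<and> ?M = ?C) \<or> (diam G = 3 \<and> diam ?M = 3 \<and> proper_subgraph ?M ?C)"
  proof (cases "\<exists>u\<in>pverts G. \<exists>v\<in>pverts G. u \<noteq> v \<and> gdist G u v = 3")
    case True
    then obtain u v where uv: "u \<in> pverts G" "v \<in> pverts G" "u \<noteq> v" "gdist G u v = 3" by blast
    have "diam G = 3" using le3(1) uv(1,2,4) by (rule diam_eqI)
    moreover have "diam ?M = 3"
      by (rule M.diam_eqI[of _ u v]) (use uv le3(2) three[OF uv(1-3)] in simp_all)
    moreover have "(u, v) \<in> parcs ?C" "(u, v) \<notin> parcs ?M"
      using uv by (auto simp: parcs_metamour_iff complement_graph_def simp flip: gdist_eq_1_iff)
    then have "proper_subgraph ?M ?C"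
      using M_sub_C M.wf_digraph_axioms C.wf_digraph_axioms
      by (auto simp: proper_subgraph_def subgraph_def compatible_def complement_graph_def)
    ultimately show ?thesis by blast
  next
    case False
    have le2: "gdist G u v \<le> 2" "gdist ?M u v \<le> 2" if "u \<in> pverts G" "v \<in> pverts G" for u v
    proof -
      have "gdist G u v \<le> 2 \<and> gdist ?M u v \<le> 2"
      proof (cases "u = v")
        case True
        with that show ?thesis
          by (simp add: gdist_self[OF pair_wf_digraph_axioms] gdist_self[OF M.pair_wf_digraph_axioms])
      next
        case neq: False
        with cases[OF that] three[OF that] False that show ?thesis by auto
      qed
      then show "gdist G u v \<le> 2" "gdist ?M u v \<le> 2" by auto
    qed
    have "parcs G \<noteq> {}" "parcs ?M \<noteq> {}"
      using metamour_eq_self_if_parcs_empty[OF assms(1)]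
        metamour_eq_self_if_parcs_empty[OF M.pair_graph_axioms] inv neq by auto
    then obtain a b x y where ab: "(a, b) \<in> parcs G" and xy: "(x, y) \<in> parcs ?M" by auto
    have "diam G = 2"
      using xy le2 by (auto simp: parcs_metamour_iff intro: diam_eqI)
    moreover have "diam ?M = 2"
      by (rule M.diam_eqI[of _ a b])
        (use le2 ab two in_arcsD1[OF ab] in_arcsD2[OF ab] in \<open>auto simp: gdist_eq_1_iff\<close>)
    moreover have "parcs ?C \<subseteq> parcs ?M"
    proof clarify
      fix u v assume "(u, v) \<in> parcs ?C"
      then have uv: "u \<in> pverts G" "v \<in> pverts G" "u \<noteq> v" "gdist G u v \<noteq> 1"
        by (auto simp: complement_graph_def gdist_eq_1_iff)
      with cases(1)[OF uv(1-3)] False show "(u, v) \<in> parcs ?M"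
        by (auto simp: parcs_metamour_iff)
    qed
    with M_sub_C have "?M = ?C"
      by (intro pair_pre_digraph.equality) (auto simp: complement_graph_def)
    ultimately show ?thesis by blast
  qed
  with conn one two three show ?thesis by blast
qed

end
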